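(* Let $k>2$ be a real number and let $N\geq 1$ be an integer. Then there exist a constant $C>0$ and a function $\varphi\in C^\infty(\mathbb{R}^N)$ with $\varphi>0$ in $\mathbb{R}^N$ such that the equation $\operatorname{div}(\varphi^2\nabla\sigma)=0$ in $\mathbb{R}^N$ admits a nonconstant classical solution $\sigma\in C^\infty(\mathbb{R}^N)$ satisfying $$\int_{B_R}(\varphi\sigma)^2\,dx\leq C R^k\quad\text{for every } R\geq 1.$$
   Context: For $R>0$, $B_R=\{x\in\mathbb{R}^N: |x|<R\}$ denotes the open Euclidean ball of radius $R$ centered at the origin. *)

theory Defs
  imports "HOL-Analysis.Analysis"
begin

definition partial_deriv :: "'n \<Rightarrow> (real ^ 'n \<Rightarrow> real) \<Rightarrow> real ^ 'n \<Rightarrow> real"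
  where "partial_deriv i f x = frechet_derivative f (at x) (axis i 1)"

(* frechet_derivative is an unspecified choice where f is not differentiable, so
   every use of the partial derivatives is guarded by differentiability of f. *)
fun C_class :: "nat \<Rightarrow> (real ^ 'n \<Rightarrow> real) \<Rightarrow> bool"
  where
    "C_class 0 f \<longleftrightarrow> continuous_on UNIV f"
  | "C_class (Suc m) f \<longleftrightarrow>
       (\<forall>x. f differentiable (at x)) \<and> (\<forall>i. C_class m (partial_deriv i f))"

definition C_infinity :: "(real ^ 'n \<Rightarrow> real) \<Rightarrow> bool"
  where "C_infinity f \<longleftrightarrow> (\<forall>m. C_class m f)"

definition grad :: "(real ^ 'n \<Rightarrow> real) \<Rightarrow> real ^ 'n \<Rightarrow> real ^ 'n"
  where "grad f x = (\<chi> i. partial_deriv i f x)"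

definition divergence :: "(real ^ 'n \<Rightarrow> real ^ 'n) \<Rightarrow> real ^ 'n \<Rightarrow> real"
  where "divergence F x = (\<Sum>i\<in>UNIV. partial_deriv i (\<lambda>y. F y $ i) x)"

end

theory Submission
  imports Defs "HOL-Probability.Sinc_Integral"
begin

text \<open>
  Fix one coordinate \<open>t = x $ j\<close>. A function \<open>\<sigma>\<close> of \<open>t\<close> alone with \<open>\<sigma>' > 0\<close> solves the equation for
  every weight \<open>\<phi>\<^sup>2 = g / \<sigma>'\<close> in which \<open>g\<close> depends on the other coordinates only. Take
  \<open>\<sigma> = t (1 + t\<^sup>2)\<close> to the power \<open>(k - 3) / 2\<close>, which grows like \<open>t\<close> to the power \<open>k - 2\<close>, so that
  \<open>\<sigma>\<^sup>2 / \<sigma>'\<close> grows like \<open>t\<close> to the power \<open>k - 1\<close>, and take for \<open>g\<close> an integrable product of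
  Cauchy densities. Bounding the ball by the slab \<open>\<bar>t\<bar> \<le> R\<close>, Tonelli gives the growth rate.
\<close>

section \<open>Smooth functions\<close>

lemma partial_deriv_eqI:
  assumes "(f has_derivative f') (at x)"
  shows "partial_deriv i f x = f' (axis i 1)"
  using frechet_derivative_at[OF assms] by (simp add: partial_deriv_def)

lemma has_derivative_frechet:
  "f differentiable (at x) \<Longrightarrow> (f has_derivative frechet_derivative f (at x)) (at x)"
  by (simp add: frechet_derivative_works)

text \<open>The base case is that differentiability gives continuity. The product and chain rules
  rely on this descent, since the undifferentiated factors reappear next to the derivatives.\<close>

lemma C_class_Suc_imp: "C_class (Suc m) f \<Longrightarrow> C_class m f"
proof (induction m arbitrary: f)
  case 0
  then show ?case
    by (auto simp: continuous_on_eq_continuous_at intro: differentiable_imp_continuous_within)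
next
  case (Suc m)
  then show ?case by (subst C_class.simps) auto
qed

lemma C_class_const: "C_class m (\<lambda>x :: real ^ 'n. c)"
proof (induction m arbitrary: c)
  case (Suc m)
  have "partial_deriv i (\<lambda>x. c) = (\<lambda>x. 0)" for i :: 'n
    by (rule ext, rule partial_deriv_eqI[where f' = "\<lambda>h. 0"]) simp
  then show ?case using Suc by simp
qed simp

lemma C_class_add:
  "C_class m f \<Longrightarrow> C_class m g \<Longrightarrow> C_class m (\<lambda>x. f x + g x)"
proof (induction m arbitrary: f g)
  case (Suc m)
  have "partial_deriv i (\<lambda>x. f x + g x) = (\<lambda>x. partial_deriv i f x + partial_deriv i g x)" for i
  proof
    fix x
    have "((\<lambda>x. f x + g x) has_derivative
        (\<lambda>h. frechet_derivative f (at x) h + frechet_derivative g (at x) h)) (at x)"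
      using Suc.prems by (intro has_derivative_add has_derivative_frechet) auto
    from partial_deriv_eqI[OF this]
    show "partial_deriv i (\<lambda>x. f x + g x) x = partial_deriv i f x + partial_deriv i g x"
      by (simp add: partial_deriv_def)
  qed
  then show ?case using Suc by simp
qed (auto intro: continuous_intros)

lemma C_class_mult:
  "C_class m f \<Longrightarrow> C_class m g \<Longrightarrow> C_class m (\<lambda>x. f x * g x)"
proof (induction m arbitrary: f g)
  case (Suc m)
  have "partial_deriv i (\<lambda>x. f x * g x) =
      (\<lambda>x. f x * partial_deriv i g x + partial_deriv i f x * g x)" for i
  proof
    fix x
    have "((\<lambda>x. f x * g x) has_derivative
        (\<lambda>h. f x * frechet_derivative g (at x) h + frechet_derivative f (at x) h * g x)) (at x)"
      using Suc.prems by (intro has_derivative_mult has_derivative_frechet) auto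
    from partial_deriv_eqI[OF this]
    show "partial_deriv i (\<lambda>x. f x * g x) x = f x * partial_deriv i g x + partial_deriv i f x * g x"
      by (simp add: partial_deriv_def)
  qed
  moreover have "C_class m f" "C_class m g" using Suc.prems C_class_Suc_imp by blast+
  ultimately show ?case using Suc by (simp add: C_class_add)
qed (auto intro: continuous_intros)

text \<open>A positive base keeps every real power differentiable. The exponent stays arbitrary in
  the induction because the derivative involves the exponent \<open>s - 1\<close>.\<close>

lemma C_class_powr:
  assumes "\<And>x. f x > 0"
  shows "C_class m f \<Longrightarrow> C_class m (\<lambda>x. f x powr s)"
proof (induction m arbitrary: s)
  case 0
  then show ?case using assms by (auto intro!: continuous_intros simp: less_imp_neq[symmetric])
next
  case (Suc m)
  have D: "((\<lambda>x. f x powr s) has_derivative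
      (\<lambda>h. s * f x powr (s - 1) * frechet_derivative f (at x) h)) (at x)" for x
    using assms[of x] Suc.prems
    by (auto intro!: derivative_eq_intros has_derivative_frechet
        simp: powr_diff field_simps)
  have "partial_deriv i (\<lambda>x. f x powr s) = (\<lambda>x. s * (f x powr (s - 1)) * partial_deriv i f x)" for i
    using partial_deriv_eqI[OF D] by (auto simp: partial_deriv_def)
  moreover have "C_class m f" using Suc.prems C_class_Suc_imp by blast
  ultimately show ?case using Suc D
    by (auto simp: differentiable_def intro!: C_class_mult C_class_const)
qed

lemma C_infinity_imp_differentiable: "C_infinity f \<Longrightarrow> f differentiable (at x)"
  by (metis C_class.simps(2) C_infinity_def)

lemma C_infinity_const: "C_infinity (\<lambda>x. c)"
  by (simp add: C_infinity_def C_class_const)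

lemma C_infinity_add: "C_infinity f \<Longrightarrow> C_infinity g \<Longrightarrow> C_infinity (\<lambda>x. f x + g x)"
  by (simp add: C_infinity_def C_class_add)

lemma C_infinity_mult: "C_infinity f \<Longrightarrow> C_infinity g \<Longrightarrow> C_infinity (\<lambda>x. f x * g x)"
  by (simp add: C_infinity_def C_class_mult)

lemma C_infinity_powr: "C_infinity f \<Longrightarrow> (\<And>x. f x > 0) \<Longrightarrow> C_infinity (\<lambda>x. f x powr s)"
  by (simp add: C_infinity_def C_class_powr)

lemma C_infinity_power: "C_infinity f \<Longrightarrow> C_infinity (\<lambda>x. f x ^ n)"
  by (induction n) (auto intro: C_infinity_const C_infinity_mult)

lemma C_infinity_prod:
  "(\<And>i. i \<in> A \<Longrightarrow> C_infinity (f i)) \<Longrightarrow> C_infinity (\<lambda>x. \<Prod>i\<in>A. f i x)"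
  by (induction A rule: infinite_finite_induct) (auto intro: C_infinity_const C_infinity_mult)

text \<open>Chain rule with the linear projection to coordinate \<open>j\<close>; this reduces the
  gradient of \<sigma> to one-variable calculus.\<close>

lemma partial_deriv_coord_fun:
  assumes "(g has_real_derivative D) (at (x $ j))"
  shows "partial_deriv i (\<lambda>y. g (y $ j)) x = (if i = j then D else 0)"
proof -
  have "((\<lambda>y. y $ j) has_derivative (\<lambda>h. h $ j)) (at x)"
    by (rule bounded_linear_imp_has_derivative) (rule bounded_linear_vec_nth)
  from has_derivative_compose[OF this assms[unfolded has_field_derivative_def]]
  have "((\<lambda>y. g (y $ j)) has_derivative (\<lambda>h. D * h $ j)) (at x)" .
  from partial_deriv_eqI[OF this] show ?thesis by (simp add: axis_def)
qed

lemma C_infinity_coord: "C_infinity (\<lambda>x :: real ^ 'n. x $ j)"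
  unfolding C_infinity_def
proof
  fix m show "C_class m (\<lambda>x :: real ^ 'n. x $ j)"
  proof (cases m)
    case 0
    then show ?thesis by (auto intro: continuous_intros)
  next
    case (Suc n)
    have "partial_deriv i (\<lambda>x. x $ j) = (\<lambda>x. if i = j then 1 else 0)" for i :: 'n
      by (rule ext, rule partial_deriv_coord_fun) (rule DERIV_ident)
    moreover have "(\<lambda>y. y $ j) differentiable (at x)" for x :: "real ^ 'n"
      by (rule linear_imp_differentiable) (simp add: linear_iff)
    ultimately show ?thesis using Suc by (simp add: C_class_const)
  qed
qed

lemmas C_infinity_intros = C_infinity_const C_infinity_add C_infinity_mult C_infinity_powr
  C_infinity_power C_infinity_prod C_infinity_coord

text \<open>The map \<open>s \<mapsto> f (x + s e_i)\<close> is differentiated at 0 twice, by the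
  chain rule and as a constant, and derivatives are unique. This will annihilate the
  divergence.\<close>

lemma partial_deriv_invariant:
  assumes "f differentiable (at x)" and "\<And>s. f (x + s *\<^sub>R axis i 1) = f x"
  shows "partial_deriv i f x = 0"
proof -
  have "((\<lambda>s. x + s *\<^sub>R axis i 1) has_derivative (\<lambda>s. s *\<^sub>R axis i 1)) (at (0::real))"
    by (auto intro!: derivative_eq_intros)
  moreover have "(f has_derivative frechet_derivative f (at x)) (at (x + 0 *\<^sub>R axis i 1))"
    using has_derivative_frechet[OF assms(1)] by simp
  ultimately have "((\<lambda>s. f (x + s *\<^sub>R axis i 1)) has_derivative
      (\<lambda>s. frechet_derivative f (at x) (s *\<^sub>R axis i 1))) (at (0::real))"
    by (rule has_derivative_compose)
  moreover have "((\<lambda>s. f (x + s *\<^sub>R axis i 1)) has_derivative (\<lambda>s. 0)) (at (0::real))"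
    by (simp add: assms(2))
  ultimately have "(\<lambda>s::real. frechet_derivative f (at x) (s *\<^sub>R axis i 1)) = (\<lambda>s. 0)"
    by (rule has_derivative_unique)
  from fun_cong[OF this, of 1] show ?thesis by (simp add: partial_deriv_def)
qed

section \<open>Integrals of products\<close>

lemma nn_integral_cauchy: "(\<integral>\<^sup>+x. ennreal (inverse (1 + x\<^sup>2)) \<partial>lborel) = ennreal pi"
proof -
  have "integrable lborel (\<lambda>x::real. inverse (1 + x\<^sup>2))"
    using integrable_inverse_1_plus_square by (simp add: set_integrable_def)
  then have "(\<integral>\<^sup>+x. ennreal (inverse (1 + x\<^sup>2)) \<partial>lborel) =
      ennreal (\<integral>x. inverse (1 + x\<^sup>2) \<partial>lborel)"
    by (rule nn_integral_eq_integral) simp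
  then show ?thesis
    using LBINT_inverse_1_plus_square
    by (simp add: interval_lebesgue_integral_def set_lebesgue_integral_def)
qed

text \<open>Tonelli on the product space. The product formula for \<open>lborel\<close> is indexed
  by basis vectors; \<open>reindex\<close> carries it over to coordinates through
  \<open>axis\<close>.\<close>

lemma nn_integral_vec_prod:
  fixes h :: "'n::finite \<Rightarrow> real \<Rightarrow> ennreal"
  assumes [measurable]: "\<And>i. h i \<in> borel_measurable borel"
  shows "(\<integral>\<^sup>+x. (\<Prod>i\<in>UNIV. h i (x $ i)) \<partial>(lborel :: (real ^ 'n) measure)) =
    (\<Prod>i\<in>UNIV. \<integral>\<^sup>+t. h i t \<partial>lborel)"
proof -
  have reindex: "(\<Prod>b\<in>Basis. F (axis_index b) b) = (\<Prod>i\<in>UNIV. F i (axis i 1))"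
    for F :: "'n \<Rightarrow> real ^ 'n \<Rightarrow> ennreal"
    by (simp add: Basis_vec_def UNION_singleton_eq_range prod.reindex axis_eq_axis inj_on_def
        axis_index_axis)
  have "(\<integral>\<^sup>+x. (\<Prod>b\<in>Basis. h (axis_index b) (x \<bullet> b)) \<partial>(lborel :: (real ^ 'n) measure)) =
      (\<Prod>b\<in>(Basis :: (real ^ 'n) set). \<integral>\<^sup>+t. h (axis_index b) t \<partial>lborel)"
    by (rule nn_integral_lborel_prod) auto
  then show ?thesis
    using reindex[of "\<lambda>i b. h i (_ \<bullet> b)"] reindex[of "\<lambda>i b. \<integral>\<^sup>+t. h i t \<partial>lborel"]
    by (simp add: reindex cart_eq_inner_axis)
qed

text \<open>The ball lies in the slab \<open>\<bar>x $ j\<bar> \<le> R\<close>, over which the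
  majorant is a pure product: coordinate \<open>j\<close> contributes \<open>2 * R * M\<close> and
  each of the others the Cauchy mass \<open>pi\<close>.\<close>

lemma set_integral_ball_le:
  fixes f :: "real ^ 'n \<Rightarrow> real" and j :: 'n
  assumes "R \<ge> 0" and "M \<ge> 0"
    and f: "\<And>x. x \<in> ball 0 R \<Longrightarrow> f x \<le> M * (\<Prod>i\<in>UNIV - {j}. inverse (1 + (x $ i)\<^sup>2))"
  shows "(LINT x:ball 0 R|lborel. f x) \<le> 2 * R * M * pi ^ (CARD('n) - 1)"
proof -
  define h :: "'n \<Rightarrow> real \<Rightarrow> ennreal" where
    "h i t = (if i = j then ennreal M * indicator {-R..R} t else ennreal (inverse (1 + t\<^sup>2)))" for i t
  have split: "(\<Prod>i\<in>UNIV. G i) = G j * (\<Prod>i\<in>UNIV - {j}. G i)" for G :: "'n \<Rightarrow> ennreal"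
    by (rule prod.remove) auto
  have meas: "h i \<in> borel_measurable borel" for i
    unfolding h_def by (cases "i = j") auto
  have le: "ennreal (indicator (ball 0 R) x *\<^sub>R f x) \<le> (\<Prod>i\<in>UNIV. h i (x $ i))" for x
  proof (cases "x \<in> ball 0 R")
    case True
    then have "x $ j \<in> {-R..R}"
      using component_le_norm_cart[of x j] by (auto simp: abs_le_iff)
    moreover have "(\<Prod>i\<in>UNIV - {j}. h i (x $ i)) =
        ennreal (\<Prod>i\<in>UNIV - {j}. inverse (1 + (x $ i)\<^sup>2))"
      by (simp add: h_def prod_ennreal)
    ultimately have "(\<Prod>i\<in>UNIV. h i (x $ i)) =
        ennreal (M * (\<Prod>i\<in>UNIV - {j}. inverse (1 + (x $ i)\<^sup>2)))"
      using \<open>M \<ge> 0\<close> unfolding split by (simp add: h_def ennreal_mult prod_nonneg)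
    then show ?thesis using True f[OF True] by (simp add: ennreal_leI)
  qed simp
  have "(\<integral>\<^sup>+x. ennreal (indicator (ball 0 R) x *\<^sub>R f x) \<partial>lborel) \<le>
      (\<integral>\<^sup>+x. (\<Prod>i\<in>UNIV. h i (x $ i)) \<partial>lborel)"
    by (rule nn_integral_mono) (rule le)
  also have "\<dots> = (\<integral>\<^sup>+t. h j t \<partial>lborel) * (\<Prod>i\<in>UNIV - {j}. \<integral>\<^sup>+t. h i t \<partial>lborel)"
    unfolding nn_integral_vec_prod[OF meas] by (rule split)
  also have "(\<integral>\<^sup>+t. h j t \<partial>lborel) = ennreal (2 * R * M)"
    using assms by (simp add: h_def nn_integral_cmult ennreal_mult[symmetric] mult_ac)
  also have "(\<Prod>i\<in>UNIV - {j}. \<integral>\<^sup>+t. h i t \<partial>lborel) = ennreal (pi ^ (CARD('n) - 1))"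
    by (simp add: h_def nn_integral_cauchy ennreal_power)
  finally have "(\<integral>\<^sup>+x. ennreal (indicator (ball 0 R) x *\<^sub>R f x) \<partial>lborel) \<le>
      ennreal (2 * R * M * pi ^ (CARD('n) - 1))"
    using assms by (simp add: ennreal_mult)
  \<comment> \<open>A non-integrable function has Lebesgue integral 0 by convention, so the bound on
    the nonnegative integral passes to the real integral in either case.\<close>
  then show ?thesis
    unfolding set_lebesgue_integral_def using assms by (intro integral_real_bounded) auto
qed

section \<open>The one-dimensional profile\<close>

lemma powr_minus_half_power2:
  fixes x :: real
  assumes "x > 0"
  shows "(x powr (-1/2))\<^sup>2 = inverse x"
  using assms by (simp add: powr_minus powr_half_sqrt power_inverse)

text \<open>Factoring out the lower power leaves \<open>1 + t^2 + (a - 1) * t^2\<close>, which is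
  positive for \<open>a > 0\<close>, so that the reciprocal of the derivative can serve as a
  weight.\<close>

lemma has_real_derivative_profile:
  fixes a t :: real
  shows "((\<lambda>t. t * (1 + t\<^sup>2) powr ((a - 1) / 2)) has_real_derivative
    (1 + t\<^sup>2) powr ((a - 3) / 2) * (1 + a * t\<^sup>2)) (at t)"
proof -
  have p: "1 + t\<^sup>2 > 0" by (simp add: add_pos_nonneg)
  have e: "(1 + t\<^sup>2) powr ((a - 1) / 2) = (1 + t\<^sup>2) powr ((a - 3) / 2) * (1 + t\<^sup>2)"
    using p powr_add[of "1 + t\<^sup>2" "(a - 3) / 2" 1] by (simp add: field_simps)
  have "((\<lambda>t. (1 + t\<^sup>2) powr ((a - 1) / 2)) has_real_derivative
      (a - 1) / 2 * (1 + t\<^sup>2) powr ((a - 1) / 2 - 1) * (2 * t)) (at t)"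
    using p by (auto intro!: derivative_eq_intros)
  from DERIV_mult[OF DERIV_ident this]
  have "((\<lambda>t. t * (1 + t\<^sup>2) powr ((a - 1) / 2)) has_real_derivative
      (1 + t\<^sup>2) powr ((a - 1) / 2) + (a - 1) / 2 * (1 + t\<^sup>2) powr ((a - 3) / 2) * (2 * t) * t) (at t)"
    by (simp add: field_simps)
  moreover have "(1 + t\<^sup>2) powr ((a - 1) / 2) +
      (a - 1) / 2 * (1 + t\<^sup>2) powr ((a - 3) / 2) * (2 * t) * t =
      (1 + t\<^sup>2) powr ((a - 3) / 2) * (1 + a * t\<^sup>2)"
    unfolding e by (simp add: algebra_simps power2_eq_square diff_divide_distrib)
  ultimately show ?thesis by simp
qed

text \<open>The left side is \<sigma>^2 / \<sigma>' for the profile \<sigma>. The denominator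
  dominates \<open>min 1 a * (1 + t^2)\<close>, which cancels against the bound
  \<open>t^2 \<le> 1 + t^2\<close>; what remains is a power of
  \<open>1 + t^2 \<le> 2 * R^2\<close>.\<close>

lemma profile_ratio_le:
  fixes a t R :: real
  assumes "a > 0" and "\<bar>t\<bar> \<le> R" and "R \<ge> 1"
  shows "(1 + t\<^sup>2) powr ((3 - a) / 2) / (1 + a * t\<^sup>2) * (t * (1 + t\<^sup>2) powr ((a - 1) / 2))\<^sup>2
    \<le> 2 powr ((a + 1) / 2) / min 1 a * R powr (a + 1)"
proof -
  have p: "1 + t\<^sup>2 > 0" by (simp add: add_pos_nonneg)
  have m: "min 1 a > 0" using assms by simp
  have "min 1 a * t\<^sup>2 \<le> a * t\<^sup>2" by (intro mult_right_mono) auto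
  then have q: "min 1 a * (1 + t\<^sup>2) \<le> 1 + a * t\<^sup>2" by (simp add: distrib_left add_mono)
  have "(1 + t\<^sup>2) powr ((3 - a) / 2) * (t * (1 + t\<^sup>2) powr ((a - 1) / 2))\<^sup>2 =
      (1 + t\<^sup>2) powr ((3 - a) / 2 + (a - 1) / 2 + (a - 1) / 2) * t\<^sup>2"
    by (simp only: powr_add power_mult_distrib) (simp add: power2_eq_square)
  also have "\<dots> = (1 + t\<^sup>2) powr ((a + 1) / 2) * t\<^sup>2"
    by (simp add: field_simps)
  also have "\<dots> \<le> (1 + t\<^sup>2) powr ((a + 1) / 2) * (1 + t\<^sup>2)"
    by (intro mult_left_mono) auto
  finally have num: "(1 + t\<^sup>2) powr ((3 - a) / 2) * (t * (1 + t\<^sup>2) powr ((a - 1) / 2))\<^sup>2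
      \<le> (1 + t\<^sup>2) powr ((a + 1) / 2) * (1 + t\<^sup>2)" .
  have "(1 + t\<^sup>2) powr ((3 - a) / 2) / (1 + a * t\<^sup>2) * (t * (1 + t\<^sup>2) powr ((a - 1) / 2))\<^sup>2 \<le>
      (1 + t\<^sup>2) powr ((a + 1) / 2) * (1 + t\<^sup>2) / (min 1 a * (1 + t\<^sup>2))"
    using frac_le[OF _ num _ q] m p by simp
  also have "\<dots> = (1 + t\<^sup>2) powr ((a + 1) / 2) / min 1 a"
    using p by simp
  also have "\<dots> \<le> (2 * R\<^sup>2) powr ((a + 1) / 2) / min 1 a"
  proof -
    have "t\<^sup>2 \<le> R\<^sup>2" using assms by (simp add: abs_le_square_iff[symmetric])
    moreover have "1 \<le> R\<^sup>2" using assms by simp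
    ultimately have "1 + t\<^sup>2 \<le> 2 * R\<^sup>2" by linarith
    then show ?thesis using assms m by (intro divide_right_mono powr_mono2) auto
  qed
  also have "(2 * R\<^sup>2) powr ((a + 1) / 2) = 2 powr ((a + 1) / 2) * R powr (a + 1)"
  proof -
    have "2 * ((a + 1) / 2) = a + 1" by simp
    then show ?thesis
      using assms by (simp only: powr_mult powr_powr flip: powr_numeral)
  qed
  finally show ?thesis by simp
qed

section \<open>The weighted equation and its growth estimate in N dimensions\<close>

theorem theorem1p3:
  fixes k :: real
  assumes "k > 2"
  shows "\<exists>(C::real) (\<phi> :: real ^ 'n \<Rightarrow> real).
           C > 0 \<and> C_infinity \<phi> \<and> (\<forall>x. \<phi> x > 0) \<and>
           (\<exists>\<sigma> :: real ^ 'n \<Rightarrow> real.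
              C_infinity \<sigma> \<and>
              \<not> \<sigma> constant_on UNIV \<and>
              (\<forall>x. divergence (\<lambda>y. (\<phi> y)\<^sup>2 *\<^sub>R grad \<sigma> y) x = 0) \<and>
              (\<forall>R\<ge>1. (LINT x:ball 0 R|lborel. (\<phi> x * \<sigma> x)\<^sup>2) \<le> C * R powr k))"
proof -
  \<comment> \<open>The growth exponent of \<sigma>; the hypothesis \<open>k > 2\<close> says
    exactly that it is positive.\<close>
  define a where "a = k - 2"
  have a: "a > 0" using assms by (simp add: a_def)
  fix j :: 'n
  define \<sigma> :: "real ^ 'n \<Rightarrow> real" where
    "\<sigma> x = x $ j * (1 + (x $ j)\<^sup>2) powr ((a - 1) / 2)" for x
  define W :: "real ^ 'n \<Rightarrow> real" where
    "W x = (\<Prod>i\<in>UNIV - {j}. (1 + (x $ i)\<^sup>2) powr (-1/2))" for x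
  \<comment> \<open>The square root of g / \<sigma>' with g = \<open>W^2\<close>, written with
    powers of positive bases so that smoothness and positivity are immediate. In dimension one
    \<open>W\<close> is the empty product 1.\<close>
  define \<phi> :: "real ^ 'n \<Rightarrow> real" where
    "\<phi> x = (1 + (x $ j)\<^sup>2) powr ((3 - a) / 4) * (1 + a * (x $ j)\<^sup>2) powr (-1/2) * W x" for x
  \<comment> \<open>\<open>K\<close> is the constant of the one-dimensional bound; \<open>C\<close>
    adds the slab width and the mass \<open>pi\<close> of each remaining coordinate.\<close>
  define K where "K = 2 powr ((a + 1) / 2) / min 1 a"
  define C where "C = 2 * K * pi ^ (CARD('n) - 1)"
  have K: "K > 0" using a by (simp add: K_def)
  have pos: "1 + t\<^sup>2 > 0" "1 + a * t\<^sup>2 > 0" for t :: real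
    using a by (simp_all add: add_pos_nonneg)
  have W_pos: "W x > 0" for x
    unfolding W_def using pos by (intro prod_pos) (simp add: less_imp_neq[symmetric])
  have W_sq: "(W x)\<^sup>2 = (\<Prod>i\<in>UNIV - {j}. inverse (1 + (x $ i)\<^sup>2))" for x
    unfolding W_def prod_power_distrib powr_minus_half_power2[OF pos(1)] ..
  have \<phi>_sq: "(\<phi> x)\<^sup>2 = (1 + (x $ j)\<^sup>2) powr ((3 - a) / 2) / (1 + a * (x $ j)\<^sup>2) * (W x)\<^sup>2" for x
  proof -
    have "((1 + (x $ j)\<^sup>2) powr ((3 - a) / 4))\<^sup>2 = (1 + (x $ j)\<^sup>2) powr ((3 - a) / 2)"
      by (simp add: power2_eq_square flip: powr_add)
    moreover have "((1 + a * (x $ j)\<^sup>2) powr (-1/2))\<^sup>2 = 1 / (1 + a * (x $ j)\<^sup>2)"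
      unfolding powr_minus_half_power2[OF pos(2)] by (rule inverse_eq_divide)
    ultimately show ?thesis by (simp only: \<phi>_def power_mult_distrib times_divide_eq_right mult_1_right)
  qed
  have W_smooth: "C_infinity W"
    unfolding W_def[abs_def] by (intro C_infinity_intros pos)
  have \<phi>_smooth: "C_infinity \<phi>"
    unfolding \<phi>_def[abs_def] by (intro C_infinity_intros W_smooth pos)
  have \<phi>_pos: "\<phi> x > 0" for x
    using W_pos pos[of "x $ j"] by (simp add: \<phi>_def)
  have \<sigma>_smooth: "C_infinity \<sigma>"
    unfolding \<sigma>_def[abs_def] by (intro C_infinity_intros pos)
  have \<sigma>_nonconst: "\<not> \<sigma> constant_on UNIV"
  proof
    assume "\<sigma> constant_on UNIV"
    then have "\<sigma> (axis j 1) = \<sigma> 0" by (auto simp: constant_on_def)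
    then show False by (simp add: \<sigma>_def axis_def)
  qed
  have \<sigma>_deriv: "partial_deriv i \<sigma> x =
      (if i = j then (1 + (x $ j)\<^sup>2) powr ((a - 3) / 2) * (1 + a * (x $ j)\<^sup>2) else 0)" for i x
    unfolding \<sigma>_def[abs_def] by (rule partial_deriv_coord_fun) (rule has_real_derivative_profile)
  \<comment> \<open>The weight cancels \<sigma>', leaving a flux along axis \<open>j\<close> whose
    size \<open>W^2\<close> does not involve coordinate \<open>j\<close>. Each term of the
    divergence therefore vanishes separately.\<close>
  have flux: "((\<phi> y)\<^sup>2 *\<^sub>R grad \<sigma> y) $ i = (if i = j then (W y)\<^sup>2 else 0)" for i y
  proof -
    have "(1 + (y $ j)\<^sup>2) powr ((3 - a) / 2) * (1 + (y $ j)\<^sup>2) powr ((a - 3) / 2) = 1"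
      using pos[of "y $ j"] by (simp add: add_divide_distrib[symmetric] flip: powr_add)
    then show ?thesis
      using pos(2)[of "y $ j"] by (simp add: grad_def \<sigma>_deriv \<phi>_sq field_simps)
  qed
  have "partial_deriv i (\<lambda>y. ((\<phi> y)\<^sup>2 *\<^sub>R grad \<sigma> y) $ i) x = 0" for i x
    unfolding flux
  proof (rule partial_deriv_invariant)
    have "C_infinity (\<lambda>y. if i = j then (W y)\<^sup>2 else 0)"
      by (cases "i = j") (simp_all add: C_infinity_intros W_smooth)
    then show "(\<lambda>y. if i = j then (W y)\<^sup>2 else 0) differentiable (at x)"
      by (rule C_infinity_imp_differentiable)
    have "W (x + s *\<^sub>R axis j 1) = W x" for s
      unfolding W_def by (intro prod.cong) (auto simp: axis_def)
    then show "(if i = j then (W (x + s *\<^sub>R axis i 1))\<^sup>2 else 0) =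
        (if i = j then (W x)\<^sup>2 else 0)" for s
      by simp
  qed
  then have div: "divergence (\<lambda>y. (\<phi> y)\<^sup>2 *\<^sub>R grad \<sigma> y) x = 0" for x
    by (simp add: divergence_def)
  have bound: "(LINT x:ball 0 R|lborel. (\<phi> x * \<sigma> x)\<^sup>2) \<le> C * R powr k" if R: "R \<ge> 1" for R
  proof -
    have "(\<phi> x * \<sigma> x)\<^sup>2 \<le> K * R powr (a + 1) * (\<Prod>i\<in>UNIV - {j}. inverse (1 + (x $ i)\<^sup>2))"
      if "x \<in> ball 0 R" for x
    proof -
      have "\<bar>x $ j\<bar> \<le> R" using that component_le_norm_cart[of x j] by simp
      \<comment> \<open>Multiplying the one-dimensional bound by \<open>W^2\<close> restores the
        other coordinates on both sides.\<close>
      from mult_right_mono[OF profile_ratio_le[OF a this R], of "(W x)\<^sup>2"]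
      show ?thesis by (simp add: power_mult_distrib \<phi>_sq \<sigma>_def K_def mult_ac flip: W_sq)
    qed
    then have "(LINT x:ball 0 R|lborel. (\<phi> x * \<sigma> x)\<^sup>2) \<le>
        2 * R * (K * R powr (a + 1)) * pi ^ (CARD('n) - 1)"
      using R K by (intro set_integral_ball_le) auto
    \<comment> \<open>The slab width supplies one more power of \<open>R\<close>, which raises the
      exponent from \<open>a + 1\<close> to \<open>a + 2 = k\<close>.\<close>
    also have "\<dots> = C * (R powr 1 * R powr (a + 1))"
      using R by (simp add: C_def)
    also have "\<dots> = C * R powr k"
      unfolding powr_add[symmetric] by (simp add: a_def)
    finally show ?thesis .
  qed
  have "C > 0" using K by (simp add: C_def)
  with \<phi>_smooth \<phi>_pos \<sigma>_smooth \<sigma>_nonconst div bound show ?thesis by blast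
qed

end
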